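(* Consider the semi-online secretary setting for submodular maximization under a $k$-uniform matroid constraint: a non-negative submodular function $f$ with $f(\emptyset)=0$ is defined on a set of elements that arrive one at a time in uniformly random order; the algorithm knows the value $\mathrm{OPT}=\max_{|C|\le k}f(C)$ in advance, has no computational restrictions, must irrevocably decide upon each arrival whether to select the element, and may select at most $k$ elements. Then no algorithm in this setting achieves approximation better than a factor $\frac89$ for $k=2$, or better than a factor $\frac{17}{18}$ for any even $k$; that is, for $k=2$ (resp. any even $k$) there is no algorithm whose expected value is at least $c\cdot\mathrm{OPT}$ on every instance for some $c>\frac89$ (resp. $c>\frac{17}{18}$).
   Context: A function $f$ is submodular if $f(A)+f(B)\ge f(A\cup B)+f(A\cap B)$ for all $A,B$. *)

theory Defs
  imports "HOL-Probability.Probability" "HOL-Combinatorics.Multiset_Permutations"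
begin

definition submodular_on :: "'a set \<Rightarrow> ('a set \<Rightarrow> real) \<Rightarrow> bool" where
  "submodular_on V f \<longleftrightarrow>
     (\<forall>A B. A \<subseteq> V \<longrightarrow> B \<subseteq> V \<longrightarrow> f A + f B \<ge> f (A \<union> B) + f (A \<inter> B))"

text \<open>
  Elements are named by natural numbers, and every finite set of names may be a ground set.
  Only the values of \<open>f\<close> on subsets of \<open>V\<close> are part of the instance.
\<close>

definition submodular_instance :: "nat set \<Rightarrow> (nat set \<Rightarrow> real) \<Rightarrow> bool" where
  "submodular_instance V f \<longleftrightarrow>
     finite V \<and> f {} = 0 \<and> (\<forall>A\<subseteq>V. f A \<ge> 0) \<and> submodular_on V f"

definition opt :: "nat \<Rightarrow> nat set \<Rightarrow> (nat set \<Rightarrow> real) \<Rightarrow> real" where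
  "opt k V f = Max (f ` {C. C \<subseteq> V \<and> card C \<le> k})"

text \<open>
  An algorithm is an arbitrary, possibly randomized, decision rule. The arguments of
  \<open>alg n w xs g S\<close> are everything it knows when the last element of \<open>xs\<close> arrives: the number
  \<open>n\<close> of elements, the optimal value \<open>w\<close>, the elements \<open>xs\<close> that have arrived so far in order
  of arrival, the values \<open>g\<close> of the objective on all subsets of \<open>set xs\<close>, and the set \<open>S\<close> of
  elements selected so far. The result is the distribution of the decision to select the
  current element (\<open>True\<close>) or to reject it (\<open>False\<close>). As \<open>xs\<close> and \<open>S\<close> determine all earlier
  decisions, drawing fresh randomness at each step is no loss of generality compared with
  internal randomness that is shared between the steps.
\<close>

type_synonym algorithm =
  "nat \<Rightarrow> real \<Rightarrow> nat list \<Rightarrow> (nat set \<Rightarrow> real) \<Rightarrow> nat set \<Rightarrow> bool pmf"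

text \<open>
  \<open>run alg n w f xs S es\<close> is the distribution of the final selection when \<open>xs\<close> has arrived,
  \<open>S\<close> has been selected, and \<open>es\<close> is still to come. Passing \<open>restrict f (Pow (set _))\<close> to the
  algorithm hides all values that involve elements still to come.
\<close>

primrec run :: "algorithm \<Rightarrow> nat \<Rightarrow> real \<Rightarrow> (nat set \<Rightarrow> real) \<Rightarrow>
    nat list \<Rightarrow> nat set \<Rightarrow> nat list \<Rightarrow> nat set pmf" where
  "run alg n w f xs S [] = return_pmf S"
| "run alg n w f xs S (e # es) =
     bind_pmf (alg n w (xs @ [e]) (restrict f (Pow (set (xs @ [e])))) S)
       (\<lambda>select. run alg n w f (xs @ [e]) (if select then insert e S else S) es)"

definition outcome :: "nat \<Rightarrow> algorithm \<Rightarrow> nat set \<Rightarrow> (nat set \<Rightarrow> real) \<Rightarrow> nat set pmf" where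
  "outcome k alg V f =
     bind_pmf (pmf_of_set (permutations_of_set V))
       (\<lambda>es. run alg (card V) (opt k V f) f [] {} es)"

definition selects_at_most :: "nat \<Rightarrow> algorithm \<Rightarrow> bool" where
  "selects_at_most k alg \<longleftrightarrow>
     (\<forall>V f. submodular_instance V f \<longrightarrow> (\<forall>S\<in>set_pmf (outcome k alg V f). card S \<le> k))"

definition achieves_factor :: "nat \<Rightarrow> real \<Rightarrow> algorithm \<Rightarrow> bool" where
  "achieves_factor k c alg \<longleftrightarrow>
     (\<forall>V f. submodular_instance V f \<longrightarrow>
        measure_pmf.expectation (outcome k alg V f) f \<ge> c * opt k V f)"

end

theory Submission
  imports Defs
begin

text \<open>
  On a ground set \<open>V\<close> of three elements let \<open>f\<^sub>c A\<close> be \<open>1\<close> if the trap \<open>c\<close> lies in \<open>A\<close>, and the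
  cardinality of \<open>A\<close> otherwise. The optimum is \<open>2\<close>, attained by \<open>V - {c}\<close> only. The first
  arrival \<open>x\<close> looks the same for all three positions of the trap, so it is selected with the same
  probability \<open>p\<close>. Selecting \<open>x\<close> limits the final value to \<open>1\<close> if \<open>x = c\<close>, rejecting it
  limits the value to \<open>1\<close> if \<open>x \<noteq> c\<close>. Hence the three expected values sum to at most
  \<open>(2 - p) + 2 * (1 + p) \<le> 5\<close>, and no algorithm beats the factor \<open>5 / 6\<close>. As \<open>f\<^sub>c\<close> is not
  monotone, a larger budget \<open>k\<close> neither raises the optimum nor helps the algorithm, so the same
  instances serve for every \<open>k \<ge> 2\<close>.
\<close>

lemma set_pmf_run:
  "T \<in> set_pmf (run alg n w f xs S es) \<Longrightarrow> S \<subseteq> T \<and> T \<subseteq> S \<union> set es"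
proof (induction es arbitrary: xs S)
  case (Cons e es)
  then obtain b where
    "T \<in> set_pmf (run alg n w f (xs @ [e]) (if b then insert e S else S) es)"
    by auto
  from Cons.IH[OF this] show ?case by (cases b) auto
qed simp

text \<open>Finite support makes every real-valued function integrable, however the algorithm
  randomizes.\<close>

lemma finite_set_pmf_run:
  assumes "finite S"
  shows "finite (set_pmf (run alg n w f xs S es))"
  by (rule finite_subset[of _ "Pow (S \<union> set es)"]) (use assms set_pmf_run in blast)+

text \<open>Whether \<open>x\<close> is kept is settled at its arrival: decisions are irrevocable
  and \<open>x\<close> does not recur in \<open>es\<close>. For fixed \<open>n\<close> and
  \<open>w\<close>, this event thus depends on \<open>f\<close> only through \<open>f {}\<close> and
  \<open>f {x}\<close>.\<close>

lemma map_pmf_run_mem: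
  assumes "x \<notin> set es"
  shows "map_pmf (\<lambda>T. x \<in> T) (run alg n w f [] {} (x # es))
           = alg n w [x] (restrict f (Pow {x})) {}"
proof -
  have "map_pmf (\<lambda>T. x \<in> T) (run alg n w f [x] (if b then {x} else {}) es) = return_pmf b" for b
  proof -
    have "map_pmf (\<lambda>T. x \<in> T) (run alg n w f [x] (if b then {x} else {}) es)
        = map_pmf (\<lambda>_. b) (run alg n w f [x] (if b then {x} else {}) es)"
      by (intro map_pmf_cong refl) (use assms set_pmf_run in \<open>fastforce split: if_splits\<close>)
    then show ?thesis by simp
  qed
  then show ?thesis by (simp add: map_bind_pmf bind_return_pmf')
qed

text \<open>Intersecting with \<open>V\<close> bounds the value on every set, so later estimates
  need not track that a selection lies in \<open>V\<close>.\<close>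

definition trap :: "'a set \<Rightarrow> 'a \<Rightarrow> 'a set \<Rightarrow> real" where
  "trap V c A = (if c \<in> A then 1 else real (card (A \<inter> V)))"

text \<open>Cardinality is modular, so only sets with \<open>c\<close> matter: if \<open>c\<close>
  lies in \<open>A\<close> alone, the claim reduces to
  \<open>card (A \<inter> B) \<le> card B\<close>; if in both, it is an equality.\<close>

lemma submodular_instance_trap:
  assumes "finite V"
  shows "submodular_instance V (trap V c)"
proof -
  have "trap V c A + trap V c B \<ge> trap V c (A \<union> B) + trap V c (A \<inter> B)"
    if "A \<subseteq> V" "B \<subseteq> V" for A B
  proof -
    have fin: "finite A" "finite B" using that assms finite_subset by auto
    have "A \<inter> V = A" "B \<inter> V = B" "(A \<union> B) \<inter> V = A \<union> B" "A \<inter> B \<inter> V = A \<inter> B"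
      using that by auto
    moreover have "card (A \<inter> B) \<le> card A" "card (A \<inter> B) \<le> card B"
      using fin by (auto intro: card_mono)
    ultimately show ?thesis using card_Un_Int[OF fin] by (auto simp: trap_def)
  qed
  then show ?thesis
    using assms by (auto simp: submodular_instance_def submodular_on_def trap_def)
qed

lemma trap_le_1_if_not_mem:
  assumes "card V = 3" "c \<in> V" "x \<in> V" "x \<noteq> c" "x \<notin> A"
  shows "trap V c A \<le> 1"
proof (cases "c \<in> A")
  case False
  have "finite V" using assms(1) card.infinite by fastforce
  then have "card (A \<inter> V) \<le> card (V - {x, c})"
    using False assms by (intro card_mono) auto
  also have "\<dots> = 1" using assms by (simp add: card_Diff_subset)
  finally show ?thesis using False by (simp add: trap_def)
qed (simp add: trap_def)

lemma trap_le_2: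
  assumes "card V = 3" "c \<in> V"
  shows "trap V c A \<le> 2"
proof (cases "c \<in> A")
  case False
  have "finite V" using assms(1) card.infinite by fastforce
  then have "card (A \<inter> V) \<le> card (V - {c})"
    using False by (intro card_mono) auto
  also have "\<dots> = 2" using assms by simp
  finally show ?thesis using False by (simp add: trap_def)
qed (simp add: trap_def)

lemma opt_trap:
  assumes "card V = 3" "c \<in> V" "k \<ge> 2"
  shows "opt k V (trap V c) = 2"
  unfolding opt_def
proof (rule Max_eqI)
  have "finite V" using assms(1) card.infinite by fastforce
  then show "finite (trap V c ` {C. C \<subseteq> V \<and> card C \<le> k})" by simp
  have "(V - {c}) \<inter> V = V - {c}" by blast
  then have "trap V c (V - {c}) = 2" using assms by (simp add: trap_def)
  then show "2 \<in> trap V c ` {C. C \<subseteq> V \<and> card C \<le> k}"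
    using assms by (intro image_eqI[of _ _ "V - {c}"]) auto
qed (use assms trap_le_2 in auto)

text \<open>The arrival order is fixed and only the trap varies; averaging over orders then
  preserves the bound.\<close>

lemma sum_expectation_run_trap_le:
  assumes "card V = 3" and "es \<in> permutations_of_set V"
  shows "(\<Sum>c\<in>V. measure_pmf.expectation (run alg n w (trap V c) [] {} es) (trap V c)) \<le> 5"
proof -
  have fin: "finite V" using assms(1) card.infinite by fastforce
  have es: "set es = V" "distinct es"
    using assms(2) by (auto simp: permutations_of_set_def)
  with assms(1) obtain x ys where x: "es = x # ys" by (cases es) auto
  have xV: "x \<in> V" and x_ys: "x \<notin> set ys" using es x by auto
  define R where "R c = run alg n w (trap V c) [] {} es" for c
  have integrable: "integrable (measure_pmf (R c)) h" for c and h :: "nat set \<Rightarrow> real"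
    unfolding R_def by (intro integrable_measure_pmf_finite finite_set_pmf_run) simp
  define p where "p = measure_pmf.expectation
    (alg n w [x] (restrict (trap V x) (Pow {x})) {}) (of_bool :: bool \<Rightarrow> real)"
  have mem: "measure_pmf.expectation (R c) (\<lambda>T. of_bool (x \<in> T)) = p" if "c \<in> V" for c
  proof -
    \<comment> \<open>Both functions are 0 at \<open>{}\<close> and 1 at \<open>{x}\<close>: alone,
      a trap is worth as much as any other element.\<close>
    have "restrict (trap V c) (Pow {x}) = restrict (trap V x) (Pow {x})"
      using xV by (auto simp: trap_def fun_eq_iff restrict_def subset_singleton_iff)
    then have "map_pmf (\<lambda>T. x \<in> T) (R c) = alg n w [x] (restrict (trap V x) (Pow {x})) {}"
      unfolding R_def x by (simp add: map_pmf_run_mem[OF x_ys] del: run.simps)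
    then show ?thesis unfolding p_def by (metis integral_map_pmf)
  qed
  have first: "measure_pmf.expectation (R x) (trap V x) \<le> 2 - p"
  proof -
    have "trap V x T \<le> 2 - of_bool (x \<in> T)" for T
      using trap_le_2[OF assms(1) xV, of T] by (cases "x \<in> T") (auto simp: trap_def)
    then have "measure_pmf.expectation (R x) (trap V x)
        \<le> measure_pmf.expectation (R x) (\<lambda>T. 2 - of_bool (x \<in> T))"
      by (intro integral_mono integrable)
    also have "\<dots> = 2 - p" using mem[OF xV] by (simp add: integrable)
    finally show ?thesis .
  qed
  have other: "measure_pmf.expectation (R c) (trap V c) \<le> 1 + p" if "c \<in> V - {x}" for c
  proof -
    have "trap V c T \<le> 1 + of_bool (x \<in> T)" for T
      using trap_le_2[OF assms(1), of c T] trap_le_1_if_not_mem[OF assms(1) _ xV, of c T] that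
      by (cases "x \<in> T") auto
    then have "measure_pmf.expectation (R c) (trap V c)
        \<le> measure_pmf.expectation (R c) (\<lambda>T. 1 + of_bool (x \<in> T))"
      by (intro integral_mono integrable)
    also have "\<dots> = 1 + p" using mem that by (simp add: integrable)
    finally show ?thesis .
  qed
  have "p \<le> 1"
    unfolding p_def
    by (intro measure_pmf.integral_le_const integrable_measure_pmf_finite) auto
  have "(\<Sum>c\<in>V. measure_pmf.expectation (R c) (trap V c))
      = measure_pmf.expectation (R x) (trap V x)
        + (\<Sum>c\<in>V - {x}. measure_pmf.expectation (R c) (trap V c))"
    by (rule sum.remove[OF fin xV])
  also have "\<dots> \<le> (2 - p) + (\<Sum>c\<in>V - {x}. 1 + p)"
    by (intro add_mono first sum_mono other)
  \<comment> \<open>Two traps differ from \<open>x\<close>, so the sum equals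
    \<open>4 + p\<close>.\<close>
  also have "\<dots> \<le> 5" using \<open>p \<le> 1\<close> assms(1) xV by simp
  finally show ?thesis unfolding R_def .
qed

lemma achieves_factor_le:
  assumes "k \<ge> 2" and "achieves_factor k c alg"
  shows "c \<le> 5 / 6"
proof -
  define V :: "nat set" where "V = {..<3}"
  define P where "P = permutations_of_set V"
  have V: "finite V" "card V = 3" by (auto simp: V_def)
  have P: "finite P" "P \<noteq> {}"
    using V by (auto simp: P_def)
  \<comment> \<open>The arguments \<open>3\<close> and \<open>2\<close> are the size of
    \<open>V\<close> and the optimum; being the same for all \<open>d\<close>, they do not reveal
    the trap.\<close>
  define E where "E es d =
    measure_pmf.expectation (run alg 3 2 (trap V d) [] {} es) (trap V d)" for es d
  have "2 * c \<le> (\<Sum>es\<in>P. E es d) / card P" if "d \<in> V" for d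
  proof -
    have "measure_pmf.expectation (outcome k alg V (trap V d)) (trap V d)
        = (\<Sum>es\<in>P. E es d) / card P"
      using P that V assms(1)
      by (simp add: outcome_def opt_trap pmf_expectation_bind_pmf_of_set finite_set_pmf_run
          E_def sum_divide_distrib divide_inverse_commute sum_distrib_left flip: P_def)
    moreover have "c * opt k V (trap V d)
        \<le> measure_pmf.expectation (outcome k alg V (trap V d)) (trap V d)"
      using assms(2) submodular_instance_trap[OF V(1)] unfolding achieves_factor_def by blast
    ultimately show ?thesis using opt_trap[OF V(2) that assms(1)] by simp
  qed
  then have "(\<Sum>d\<in>V. 2 * c) \<le> (\<Sum>d\<in>V. (\<Sum>es\<in>P. E es d) / card P)"
    by (rule sum_mono)
  also have "\<dots> = (\<Sum>es\<in>P. \<Sum>d\<in>V. E es d) / card P"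
    by (subst sum.swap) (simp add: sum_divide_distrib)
  also have "\<dots> \<le> (\<Sum>es\<in>P. 5) / card P"
    unfolding E_def using sum_expectation_run_trap_le[OF V(2)] P_def
    by (intro divide_right_mono sum_mono) auto
  also have "\<dots> = 5" using P by simp
  finally show ?thesis using V by simp
qed

theorem theorem8:
  shows "\<not> (\<exists>(alg :: algorithm) c :: real.
              c > 8 / 9 \<and> selects_at_most 2 alg \<and> achieves_factor 2 c alg) \<and>
         (\<forall>k :: nat. even k \<and> k > 0 \<longrightarrow>
           \<not> (\<exists>(alg :: algorithm) c :: real.
                c > 17 / 18 \<and> selects_at_most k alg \<and> achieves_factor k c alg))"
proof (intro conjI allI impI notI)
  assume "\<exists>alg c. c > 8 / 9 \<and> selects_at_most 2 alg \<and> achieves_factor 2 c alg"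
  \<comment> \<open>Here \<open>5 / 6 < 8 / 9 < 17 / 18\<close>, so one bound refutes both
    factors.\<close>
  then show False using achieves_factor_le[of 2] by force
next
  fix k :: nat
  assume "even k \<and> k > 0"
  then have "k \<ge> 2" by (auto elim: evenE)
  moreover assume "\<exists>alg c. c > 17 / 18 \<and> selects_at_most k alg \<and> achieves_factor k c alg"
  ultimately show False using achieves_factor_le[of k] by force
qed

end
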